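(* The dual $M^*$ of the space $M$ has the $w^*$-strong diameter two property.
   Context: All Banach spaces are real. For a Banach space $X$, $B_X$ is its closed unit ball and $X^*$ its topological dual; for $x\in X$, $\alpha>0$, the $w^*$-slice is $S(B_{X^*},x,\alpha)=\{x^*\in B_{X^*}: x^*(x)>\sup_{y^*\in B_{X^*}}y^*(x)-\alpha\}$. $X^*$ has the $w^*$-strong diameter two property if every convex combination of $w^*$-slices of $B_{X^*}$, i.e. every set $\sum_{i=1}^n\lambda_iS_i$ with $S_i$ $w^*$-slices of $B_{X^*}$, $\lambda_i\ge0$, $\sum_i\lambda_i=1$, has diameter $2$. The tree: $T=\{\emptyset\}\cup\{(\alpha_1,\ldots,\alpha_k): k\in\mathbb N,\ \alpha_1,\ldots,\alpha_k\in\mathbb N\}$ is the set of finite sequences of natural numbers, partially ordered by initial-segment extension, with $\emptyset$ the least element; $|(\alpha_1,\ldots,\alpha_k)|=k$ and $|\emptyset|=0$. A segment is a non-empty finite interval of $T$, i.e. a set $\{t\in T:s\le t\le s'\}$ with $s\le s'$; it is an $n$-$m$ segment if $|s|=n$ and $|s'|=m$. A finite family $\{S_1,\ldots,S_k\}$ of segments is admissible if there are $n\le m$ such that every $S_i$ is an $n$-$m$ segment and $S_i\cap S_j=\emptyset$ for $i\ne j$. On finitely nonzero functions $x:T\to\mathbb R$ consider the norm $\|x\|=\sup\sum_{i=1}^k\left|\sum_{t\in S_i}x(t)\right|$, the supremum being over all admissible families $\{S_1,\ldots,S_k\}$ of segments of $T$; $JH_\infty$ is the completion of the space of all finitely nonzero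 functions under this norm. Let $N$ be the space of finitely nonzero $x:T\to\mathbb R$ with $x(\emptyset)=0$. $M$ is the completion of $N$ under this norm, viewed as a closed subspace (a hyperplane) of $JH_\infty$. *)

theory Defs
  imports "HOL-Analysis.Analysis" "HOL-Library.Sublist"
begin

section \<open>Completion of a normed space\<close>

text \<open>Cauchy sequences, identified when their difference is a null sequence.\<close>

definition cauchy_rel ::
  "(nat \<Rightarrow> 'a::real_normed_vector) \<Rightarrow> (nat \<Rightarrow> 'a) \<Rightarrow> bool"
  where "cauchy_rel X Y \<longleftrightarrow> Cauchy X \<and> Cauchy Y \<and> (\<lambda>n. X n - Y n) \<longlonglongrightarrow> 0"

lemma Cauchy_const_seq [simp]: "Cauchy (\<lambda>_::nat. c :: 'a::real_normed_vector)"
  by (rule LIMSEQ_imp_Cauchy[OF tendsto_const])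

lemma Cauchy_norm_convergent:
  fixes X :: "nat \<Rightarrow> 'a::real_normed_vector"
  assumes "Cauchy X"
  shows "convergent (\<lambda>n. norm (X n))"
proof -
  have "Cauchy (\<lambda>n. norm (X n))"
    unfolding Cauchy_iff
  proof (intro allI impI)
    fix e :: real assume "0 < e"
    then obtain M where M: "\<And>m n. m \<ge> M \<Longrightarrow> n \<ge> M \<Longrightarrow> norm (X m - X n) < e"
      using assms unfolding Cauchy_iff by blast
    show "\<exists>M. \<forall>m\<ge>M. \<forall>n\<ge>M. norm (norm (X m) - norm (X n)) < e"
      using M norm_triangle_ineq3 by (metis le_less_trans real_norm_def)
  qed
  then show ?thesis by (simp add: Cauchy_convergent)
qed

lemma Cauchy_add_seq:
  fixes X Y :: "nat \<Rightarrow> 'a::real_normed_vector"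
  assumes "Cauchy X" "Cauchy Y"
  shows "Cauchy (\<lambda>n. X n + Y n)"
  unfolding Cauchy_iff
proof (intro allI impI)
  fix e :: real assume e: "0 < e"
  obtain M where M: "\<And>m n. m \<ge> M \<Longrightarrow> n \<ge> M \<Longrightarrow> norm (X m - X n) < e/2"
    using assms(1) e unfolding Cauchy_iff by (meson half_gt_zero)
  obtain K where K: "\<And>m n. m \<ge> K \<Longrightarrow> n \<ge> K \<Longrightarrow> norm (Y m - Y n) < e/2"
    using assms(2) e unfolding Cauchy_iff by (meson half_gt_zero)
  show "\<exists>M. \<forall>m\<ge>M. \<forall>n\<ge>M. norm (X m + Y m - (X n + Y n)) < e"
  proof (intro exI allI impI)
    fix m n assume "max M K \<le> m" "max M K \<le> n"
    then have "norm (X m - X n) < e/2" "norm (Y m - Y n) < e/2" using M K by auto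
    then show "norm (X m + Y m - (X n + Y n)) < e"
      using norm_diff_triangle_ineq[of "X m" "Y m" "X n" "Y n"] by linarith
  qed
qed

lemma Cauchy_scaleR_seq:
  fixes X :: "nat \<Rightarrow> 'a::real_normed_vector"
  assumes "Cauchy X"
  shows "Cauchy (\<lambda>n. r *\<^sub>R X n)"
  using bounded_linear.Cauchy[OF bounded_linear_scaleR_right assms] .

lemma Cauchy_uminus_seq:
  fixes X :: "nat \<Rightarrow> 'a::real_normed_vector"
  assumes "Cauchy X"
  shows "Cauchy (\<lambda>n. - X n)"
  using Cauchy_scaleR_seq[OF assms, of "-1"] by simp

lemma cauchy_rel_lim_norm:
  assumes "cauchy_rel X Y"
  shows "lim (\<lambda>n. norm (X n)) = lim (\<lambda>n. norm (Y n))"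
proof -
  have c: "convergent (\<lambda>n. norm (X n))"
    using assms Cauchy_norm_convergent by (auto simp: cauchy_rel_def)
  have "(\<lambda>n. norm (X n - Y n)) \<longlonglongrightarrow> 0"
    using assms by (auto simp: cauchy_rel_def intro: tendsto_norm_zero)
  then have "(\<lambda>n. norm (Y n) - norm (X n)) \<longlonglongrightarrow> 0"
    by (rule Lim_null_comparison[rotated])
       (simp add: norm_triangle_ineq3 norm_minus_commute[of "X _"])
  from tendsto_add[OF this c[THEN convergent_LIMSEQ_iff[THEN iffD1]]]
  have "(\<lambda>n. norm (Y n)) \<longlonglongrightarrow> lim (\<lambda>n. norm (X n))" by simp
  then show ?thesis by (simp add: limI)
qed

quotient_type (overloaded) 'a completion =
  "nat \<Rightarrow> 'a::real_normed_vector" / partial: cauchy_rel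
proof (rule part_equivpI)
  show "\<exists>x::nat \<Rightarrow> 'a. cauchy_rel x x"
    by (rule exI[of _ "\<lambda>_. 0"]) (simp add: cauchy_rel_def)
  show "symp (cauchy_rel :: (nat \<Rightarrow> 'a) \<Rightarrow> _)"
  proof (rule sympI)
    fix X Y :: "nat \<Rightarrow> 'a" assume "cauchy_rel X Y"
    then have *: "Cauchy X" "Cauchy Y" "(\<lambda>n. X n - Y n) \<longlonglongrightarrow> 0"
      unfolding cauchy_rel_def by blast+
    show "cauchy_rel Y X"
      using *(1,2) tendsto_minus[OF *(3)] unfolding cauchy_rel_def minus_diff_eq minus_zero by blast
  qed
  show "transp (cauchy_rel :: (nat \<Rightarrow> 'a) \<Rightarrow> _)"
  proof (rule transpI)
    fix X Y Z :: "nat \<Rightarrow> 'a" assume "cauchy_rel X Y" "cauchy_rel Y Z"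
    then have *: "Cauchy X" "Cauchy Z" "(\<lambda>n. X n - Y n) \<longlonglongrightarrow> 0" "(\<lambda>n. Y n - Z n) \<longlonglongrightarrow> 0"
      unfolding cauchy_rel_def by blast+
    have "(\<lambda>n. X n - Z n) \<longlonglongrightarrow> 0"
      using tendsto_add[OF *(3,4)] by simp
    then show "cauchy_rel X Z"
      using *(1,2) unfolding cauchy_rel_def by blast
  qed
qed

instantiation completion :: (real_normed_vector) real_normed_vector
begin

lift_definition zero_completion :: "'a completion" is "\<lambda>_. 0"
  by (simp add: cauchy_rel_def)

lift_definition plus_completion :: "'a completion \<Rightarrow> 'a completion \<Rightarrow> 'a completion"
  is "\<lambda>X Y n. X n + Y n"
proof -
  fix X X' Y Y' :: "nat \<Rightarrow> 'a" assume r: "cauchy_rel X X'" "cauchy_rel Y Y'"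
  then have "(\<lambda>n. (X n - X' n) + (Y n - Y' n)) \<longlonglongrightarrow> 0"
    unfolding cauchy_rel_def by (intro tendsto_add_zero) auto
  with r show "cauchy_rel (\<lambda>n. X n + Y n) (\<lambda>n. X' n + Y' n)"
    by (auto simp: cauchy_rel_def add_diff_add intro: Cauchy_add_seq)
qed

lift_definition uminus_completion :: "'a completion \<Rightarrow> 'a completion"
  is "\<lambda>X n. - X n"
proof -
  fix X Y :: "nat \<Rightarrow> 'a" assume r: "cauchy_rel X Y"
  then have "(\<lambda>n. - (X n - Y n)) \<longlonglongrightarrow> - 0"
    unfolding cauchy_rel_def by (intro tendsto_minus) auto
  with r show "cauchy_rel (\<lambda>n. - X n) (\<lambda>n. - Y n)"
    by (simp add: cauchy_rel_def Cauchy_uminus_seq)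
qed

definition minus_completion :: "'a completion \<Rightarrow> 'a completion \<Rightarrow> 'a completion"
  where "minus_completion x y = x + - y"

lift_definition scaleR_completion :: "real \<Rightarrow> 'a completion \<Rightarrow> 'a completion"
  is "\<lambda>r X n. r *\<^sub>R X n"
proof -
  fix r and X Y :: "nat \<Rightarrow> 'a" assume R: "cauchy_rel X Y"
  then have "(\<lambda>n. r *\<^sub>R (X n - Y n)) \<longlonglongrightarrow> r *\<^sub>R 0"
    unfolding cauchy_rel_def by (intro tendsto_scaleR tendsto_const) auto
  with R show "cauchy_rel (\<lambda>n. r *\<^sub>R X n) (\<lambda>n. r *\<^sub>R Y n)"
    by (simp add: cauchy_rel_def Cauchy_scaleR_seq scaleR_diff_right)
qed

lift_definition norm_completion :: "'a completion \<Rightarrow> real"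
  is "\<lambda>X. lim (\<lambda>n. norm (X n))"
  by (rule cauchy_rel_lim_norm)

definition dist_completion :: "'a completion \<Rightarrow> 'a completion \<Rightarrow> real"
  where "dist_completion x y = norm (x - y)"

definition sgn_completion :: "'a completion \<Rightarrow> 'a completion"
  where "sgn_completion x = inverse (norm x) *\<^sub>R x"

definition uniformity_completion :: "('a completion \<times> 'a completion) filter"
  where "uniformity_completion = (INF e\<in>{0 <..}. principal {(x, y). dist x y < e})"

definition open_completion :: "'a completion set \<Rightarrow> bool"
  where "open_completion S = (\<forall>x\<in>S. \<forall>\<^sub>F (x', y) in uniformity. x' = x \<longrightarrow> y \<in> S)"

lemma cauchy_relD: "cauchy_rel X X \<Longrightarrow> (\<lambda>n. norm (X n)) \<longlonglongrightarrow> lim (\<lambda>n. norm (X n))"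
  using Cauchy_norm_convergent by (auto simp: cauchy_rel_def convergent_LIMSEQ_iff)

instance
proof
  fix x y z :: "'a completion" and a b :: real
  show "x + y + z = x + (y + z)"
    by transfer (auto simp: cauchy_rel_def add.assoc intro!: Cauchy_add_seq)
  show "x + y = y + x"
    by transfer (auto simp: cauchy_rel_def add.commute intro!: Cauchy_add_seq)
  show "0 + x = x" by transfer (auto simp: cauchy_rel_def)
  show "- x + x = 0" by transfer (auto simp: cauchy_rel_def)
  show "x - y = x + - y" by (fact minus_completion_def)
  show "a *\<^sub>R (x + y) = a *\<^sub>R x + a *\<^sub>R y"
    by transfer (auto simp: cauchy_rel_def scaleR_add_right intro!: Cauchy_add_seq Cauchy_scaleR_seq)
  show "(a + b) *\<^sub>R x = a *\<^sub>R x + b *\<^sub>R x"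
    by transfer (auto simp: cauchy_rel_def scaleR_add_left intro!: Cauchy_add_seq Cauchy_scaleR_seq)
  show "a *\<^sub>R b *\<^sub>R x = (a * b) *\<^sub>R x"
    by transfer (auto simp: cauchy_rel_def intro!: Cauchy_scaleR_seq)
  show "1 *\<^sub>R x = x" by transfer (auto simp: cauchy_rel_def)
  show "dist x y = norm (x - y)" by (fact dist_completion_def)
  show "sgn x = inverse (norm x) *\<^sub>R x" by (fact sgn_completion_def)
  show "uniformity = (INF e\<in>{0 <..}. principal {(x, y :: 'a completion). dist x y < e})"
    by (fact uniformity_completion_def)
  show "open U = (\<forall>x\<in>U. \<forall>\<^sub>F (x', y) in uniformity. x' = x \<longrightarrow> y \<in> U)"
    for U :: "'a completion set" by (fact open_completion_def)
  show "norm x = 0 \<longleftrightarrow> x = 0"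
  proof transfer
    fix X :: "nat \<Rightarrow> 'a" assume X: "cauchy_rel X X"
    show "lim (\<lambda>n. norm (X n)) = 0 \<longleftrightarrow> cauchy_rel X (\<lambda>_. 0)"
    proof
      assume "lim (\<lambda>n. norm (X n)) = 0"
      then have "X \<longlonglongrightarrow> 0" using cauchy_relD[OF X] by (simp add: tendsto_norm_zero_iff)
      then show "cauchy_rel X (\<lambda>_. 0)" using X by (simp add: cauchy_rel_def)
    next
      assume "cauchy_rel X (\<lambda>_. 0)"
      then show "lim (\<lambda>n. norm (X n)) = 0" using cauchy_rel_lim_norm by fastforce
    qed
  qed
  show "norm (x + y) \<le> norm x + norm y"
  proof transfer
    fix X Y :: "nat \<Rightarrow> 'a" assume XY: "cauchy_rel X X" "cauchy_rel Y Y"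
    then have "cauchy_rel (\<lambda>n. X n + Y n) (\<lambda>n. X n + Y n)"
      by (auto simp: cauchy_rel_def intro: Cauchy_add_seq)
    from LIMSEQ_le[OF cauchy_relD[OF this] tendsto_add[OF XY[THEN cauchy_relD]]]
    show "lim (\<lambda>n. norm (X n + Y n)) \<le> lim (\<lambda>n. norm (X n)) + lim (\<lambda>n. norm (Y n))"
      by (auto intro: norm_triangle_ineq)
  qed
  show "norm (a *\<^sub>R x) = \<bar>a\<bar> * norm x"
  proof transfer
    fix a and X :: "nat \<Rightarrow> 'a" assume "cauchy_rel X X"
    from tendsto_mult[OF tendsto_const[of "\<bar>a\<bar>"] cauchy_relD[OF this]]
    show "lim (\<lambda>n. norm (a *\<^sub>R X n)) = \<bar>a\<bar> * lim (\<lambda>n. norm (X n))"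
      by (simp add: limI)
  qed
qed

end

lift_definition embed_completion :: "'a::real_normed_vector \<Rightarrow> 'a completion"
  is "\<lambda>x _. x"
  by (simp add: cauchy_rel_def)

lemma norm_embed_completion: "norm (embed_completion x) = norm x"
  by transfer simp

lemma embed_completion_0: "embed_completion 0 = 0"
  by transfer (simp add: cauchy_rel_def)

lemma embed_completion_add: "embed_completion (x + y) = embed_completion x + embed_completion y"
  by transfer (simp add: cauchy_rel_def)

lemma embed_completion_scaleR: "embed_completion (r *\<^sub>R x) = r *\<^sub>R embed_completion x"
  by transfer (simp add: cauchy_rel_def)

lemma embed_completion_uminus: "embed_completion (- x) = - embed_completion x"
  by transfer (simp add: cauchy_rel_def)

lemma embed_completion_diff: "embed_completion (x - y) = embed_completion x - embed_completion y"
  using embed_completion_add[of x "- y"] by (simp add: embed_completion_uminus)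

lemma dist_embed_completion: "dist (embed_completion x) (embed_completion y) = dist x y"
  by (simp add: dist_norm norm_embed_completion flip: embed_completion_diff)

lemma embed_tendsto_abs_completion:
  assumes X: "Cauchy X"
  shows "(\<lambda>k. embed_completion (X k)) \<longlonglongrightarrow> abs_completion X"
proof (rule metric_LIMSEQ_I)
  fix e :: real assume e: "0 < e"
  then obtain M where M: "\<And>m n. m \<ge> M \<Longrightarrow> n \<ge> M \<Longrightarrow> norm (X m - X n) < e/2"
    using X unfolding Cauchy_iff by (meson half_gt_zero)
  show "\<exists>M. \<forall>k\<ge>M. dist (embed_completion (X k)) (abs_completion X) < e"
  proof (intro exI allI impI)
    fix k assume k: "M \<le> k"
    have c1: "cauchy_rel (\<lambda>_. X k) (\<lambda>_. X k)" by (simp add: cauchy_rel_def)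
    have c2: "cauchy_rel (\<lambda>n. - X n) (\<lambda>n. - X n)" "cauchy_rel X X"
      using X by (auto simp: cauchy_rel_def intro: Cauchy_uminus_seq)
    have c3: "cauchy_rel (\<lambda>n. X k + - X n) (\<lambda>n. X k + - X n)"
      using c1 c2 Cauchy_add_seq[of "\<lambda>_. X k" "\<lambda>n. - X n"] by (auto simp: cauchy_rel_def)
    have "embed_completion (X k) - abs_completion X = abs_completion (\<lambda>n. X k + - X n)"
      unfolding minus_completion_def embed_completion.abs_eq
        uminus_completion.abs_eq[OF c2(2)] plus_completion.abs_eq[OF c1 c2(1)] ..
    then have "dist (embed_completion (X k)) (abs_completion X) = lim (\<lambda>n. norm (X k + - X n))"
      by (simp add: dist_norm norm_completion.abs_eq[OF c3] del: add_uminus_conv_diff)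
    also have "\<dots> \<le> e/2"
    proof (rule LIMSEQ_le_const2[OF cauchy_relD[OF c3]])
      show "\<exists>N. \<forall>n\<ge>N. norm (X k + - X n) \<le> e/2"
        using M[OF k] by (intro exI[of _ M]) (auto intro: less_imp_le)
    qed
    finally show "dist (embed_completion (X k)) (abs_completion X) < e" using e by linarith
  qed
qed

lemma closure_range_embed_completion: "closure (range embed_completion) = UNIV"
proof -
  have "x \<in> closure (range embed_completion)" for x :: "'a completion"
  proof (rule completion.abs_induct[of "\<lambda>x. x \<in> closure (range embed_completion)"])
    fix X :: "nat \<Rightarrow> 'a" assume "cauchy_rel X X"
    then have "Cauchy X" unfolding cauchy_rel_def by blast
    then have "(\<lambda>k. embed_completion (X k)) \<longlonglongrightarrow> abs_completion X"
      by (rule embed_tendsto_abs_completion)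
    then show "abs_completion X \<in> closure (range embed_completion)"
      unfolding closure_sequential by (intro exI[of _ "\<lambda>k. embed_completion (X k)"]) simp
  qed
  then show ?thesis by (intro equalityI subsetI UNIV_I)
qed

instance completion :: (real_normed_vector) banach
proof
  fix F :: "nat \<Rightarrow> 'a completion" assume F: "Cauchy F"
  have "\<exists>a. dist (embed_completion a) (F k) < inverse (real (Suc k))" for k
  proof -
    have "F k \<in> closure (range embed_completion)" by (simp add: closure_range_embed_completion)
    moreover have "0 < inverse (real (Suc k))" by simp
    ultimately show ?thesis unfolding closure_approachable by blast
  qed
  then obtain a where a: "\<And>k. dist (embed_completion (a k)) (F k) < inverse (real (Suc k))"
    by metis
  have d0: "(\<lambda>k. embed_completion (a k) - F k) \<longlonglongrightarrow> 0"
  proof (rule Lim_null_comparison[OF always_eventually LIMSEQ_inverse_real_of_nat], rule allI)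
    show "norm (embed_completion (a k) - F k) \<le> inverse (real (Suc k))" for k
      using a[of k] unfolding dist_norm by (rule less_imp_le)
  qed
  have "Cauchy (\<lambda>k. (embed_completion (a k) - F k) + F k)"
    by (rule Cauchy_add_seq[OF LIMSEQ_imp_Cauchy[OF d0] F])
  then have "Cauchy (\<lambda>k. embed_completion (a k))" by simp
  then have "Cauchy a" unfolding Cauchy_def dist_embed_completion .
  then have "(\<lambda>k. embed_completion (a k)) \<longlonglongrightarrow> abs_completion a"
    by (rule embed_tendsto_abs_completion)
  from tendsto_diff[OF this d0] have "F \<longlonglongrightarrow> abs_completion a" by simp
  then show "convergent F" by (rule convergentI)
qed


section \<open>The tree and the norm\<close>

text \<open>The tree is the type \<^typ>\<open>nat list\<close> ordered by \<^const>\<open>prefix\<close>; the level of a node is its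
  \<^const>\<open>length\<close>.\<close>

definition segment :: "nat \<Rightarrow> nat \<Rightarrow> nat list set \<Rightarrow> bool"
  where "segment n m S \<longleftrightarrow>
    (\<exists>s s'. prefix s s' \<and> length s = n \<and> length s' = m \<and> S = {t. prefix s t \<and> prefix t s'})"

text \<open>Segments are nonempty, so a pairwise disjoint family has no repetitions and
  may be given as a set.\<close>

definition admissible :: "nat list set set \<Rightarrow> bool"
  where "admissible F \<longleftrightarrow>
    finite F \<and> (\<exists>n m. n \<le> m \<and> (\<forall>S\<in>F. segment n m S)) \<and> pairwise disjnt F"

definition jh_sum :: "(nat list \<Rightarrow> real) \<Rightarrow> nat list set set \<Rightarrow> real"
  where "jh_sum x F = (\<Sum>S\<in>F. \<bar>\<Sum>t\<in>S. x t\<bar>)"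

definition jh_norm :: "(nat list \<Rightarrow> real) \<Rightarrow> real"
  where "jh_norm x = (SUP F\<in>{F. admissible F}. jh_sum x F)"

lemma finite_segment: "segment n m S \<Longrightarrow> finite S"
  unfolding segment_def
proof (elim exE conjE)
  fix s s' assume "S = {t. prefix s t \<and> prefix t s'}"
  then have "S \<subseteq> set (prefixes s')" by auto
  then show "finite S" using finite_subset by blast
qed

lemma jh_sum_le:
  assumes x: "finite {t. x t \<noteq> 0}" and F: "admissible F"
  shows "jh_sum x F \<le> (\<Sum>t | x t \<noteq> 0. \<bar>x t\<bar>)"
proof -
  have fin: "finite F" "\<forall>S\<in>F. finite S"
    using F finite_segment by (auto simp: admissible_def)
  have "jh_sum x F \<le> (\<Sum>S\<in>F. \<Sum>t\<in>S. \<bar>x t\<bar>)"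
    unfolding jh_sum_def by (intro sum_mono sum_abs)
  also have "\<dots> = (\<Sum>t\<in>\<Union>F. \<bar>x t\<bar>)"
    using F fin by (subst sum.Union_disjoint) (auto simp: admissible_def pairwise_def disjnt_def)
  also have "\<dots> = (\<Sum>t\<in>\<Union>F \<inter> {t. x t \<noteq> 0}. \<bar>x t\<bar>)"
    using fin by (intro sum.mono_neutral_right) auto
  also have "\<dots> \<le> (\<Sum>t | x t \<noteq> 0. \<bar>x t\<bar>)"
    using x by (intro sum_mono2) auto
  finally show ?thesis .
qed

lemma bdd_above_jh_sum:
  assumes "finite {t. x t \<noteq> 0}"
  shows "bdd_above (jh_sum x ` {F. admissible F})"
  using jh_sum_le[OF assms] by (auto intro!: bdd_aboveI2)

lemma admissible_empty: "admissible {}"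
  by (auto simp: admissible_def)

lemma SUP_admissible_0: "(SUP F\<in>{F. admissible F}. 0 :: real) = 0"
  by (rule cSUP_const) (use admissible_empty in blast)

lemma admissible_singleton: "admissible {{t}}"
proof -
  have "segment (length t) (length t) {t}"
    unfolding segment_def by (rule exI[of _ t])+ (auto simp: prefix_order.antisym)
  then show ?thesis by (auto simp: admissible_def)
qed

lemma jh_sum_le_jh_norm:
  "finite {t. x t \<noteq> 0} \<Longrightarrow> admissible F \<Longrightarrow> jh_sum x F \<le> jh_norm x"
  unfolding jh_norm_def by (rule cSUP_upper) (auto intro: bdd_above_jh_sum)

lemma jh_norm_least:
  assumes "\<And>F. admissible F \<Longrightarrow> jh_sum x F \<le> b"
  shows "jh_norm x \<le> b"
  unfolding jh_norm_def using assms admissible_empty by (intro cSUP_least) auto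

lemma jh_norm_scaleR:
  assumes x: "finite {t. x t \<noteq> 0}"
  shows "jh_norm (\<lambda>t. a * x t) = \<bar>a\<bar> * jh_norm x"
proof -
  have s: "jh_sum (\<lambda>t. a * x t) F = \<bar>a\<bar> * jh_sum x F" for F
    by (simp add: jh_sum_def abs_mult flip: sum_distrib_left)
  have ax: "finite {t. a * x t \<noteq> 0}" by (rule finite_subset[OF _ x]) auto
  show ?thesis
  proof (cases "a = 0")
    case True
    then show ?thesis
      unfolding jh_norm_def s using SUP_admissible_0 by simp
  next
    case False
    show ?thesis
    proof (rule antisym)
      show "jh_norm (\<lambda>t. a * x t) \<le> \<bar>a\<bar> * jh_norm x"
        by (rule jh_norm_least) (auto simp: s intro!: mult_left_mono jh_sum_le_jh_norm x)
      have "jh_norm x \<le> jh_norm (\<lambda>t. a * x t) / \<bar>a\<bar>"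
        using jh_sum_le_jh_norm[OF ax] False
        by (intro jh_norm_least) (auto simp: s field_simps)
      then show "\<bar>a\<bar> * jh_norm x \<le> jh_norm (\<lambda>t. a * x t)"
        using False by (simp add: field_simps)
    qed
  qed
qed

lemma jh_norm_triangle:
  assumes x: "finite {t. x t \<noteq> 0}" and y: "finite {t. y t \<noteq> 0}"
  shows "jh_norm (\<lambda>t. x t + y t) \<le> jh_norm x + jh_norm y"
proof (rule jh_norm_least)
  fix F assume F: "admissible F"
  have "jh_sum (\<lambda>t. x t + y t) F \<le> jh_sum x F + jh_sum y F"
    unfolding jh_sum_def sum.distrib[symmetric]
    by (rule sum_mono) (simp add: sum.distrib)
  also have "\<dots> \<le> jh_norm x + jh_norm y"
    by (intro add_mono jh_sum_le_jh_norm x y F)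
  finally show "jh_sum (\<lambda>t. x t + y t) F \<le> jh_norm x + jh_norm y" .
qed

lemma jh_norm_eq_0_iff:
  assumes x: "finite {t. x t \<noteq> 0}"
  shows "jh_norm x = 0 \<longleftrightarrow> (\<forall>t. x t = 0)"
proof
  assume 0: "jh_norm x = 0"
  show "\<forall>t. x t = 0"
  proof
    fix t
    have "\<bar>x t\<bar> \<le> 0"
      using jh_sum_le_jh_norm[OF x admissible_singleton[of t]] 0 by (simp add: jh_sum_def)
    then show "x t = 0" by simp
  qed
next
  assume "\<forall>t. x t = 0"
  then have "jh_sum x = (\<lambda>_. 0)" by (auto simp: jh_sum_def)
  then show "jh_norm x = 0"
    unfolding jh_norm_def using SUP_admissible_0 by simp
qed


section \<open>The space of finitely nonzero functions\<close>

typedef fin_tree_fun = "{x :: nat list \<Rightarrow> real. finite {t. x t \<noteq> 0}}"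
  morphisms tree_apply Abs_fin_tree_fun
  by (rule exI[of _ "\<lambda>_. 0"]) simp

setup_lifting type_definition_fin_tree_fun

lemma finite_supp_tree_apply: "finite {t. tree_apply x t \<noteq> 0}"
  using tree_apply by simp

instantiation fin_tree_fun :: real_normed_vector
begin

lift_definition zero_fin_tree_fun :: fin_tree_fun is "\<lambda>_. 0" by simp

lift_definition plus_fin_tree_fun :: "fin_tree_fun \<Rightarrow> fin_tree_fun \<Rightarrow> fin_tree_fun"
  is "\<lambda>x y t. x t + y t"
  subgoal for x y by (rule finite_subset[of _ "{t. x t \<noteq> 0} \<union> {t. y t \<noteq> 0}"]) auto
  done

lift_definition minus_fin_tree_fun :: "fin_tree_fun \<Rightarrow> fin_tree_fun \<Rightarrow> fin_tree_fun"
  is "\<lambda>x y t. x t - y t"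
  subgoal for x y by (rule finite_subset[of _ "{t. x t \<noteq> 0} \<union> {t. y t \<noteq> 0}"]) auto
  done

lift_definition uminus_fin_tree_fun :: "fin_tree_fun \<Rightarrow> fin_tree_fun"
  is "\<lambda>x t. - x t" by simp

lift_definition scaleR_fin_tree_fun :: "real \<Rightarrow> fin_tree_fun \<Rightarrow> fin_tree_fun"
  is "\<lambda>a x t. a * x t"
  subgoal for a x by (rule finite_subset[of _ "{t. x t \<noteq> 0}"]) auto
  done

lift_definition norm_fin_tree_fun :: "fin_tree_fun \<Rightarrow> real" is jh_norm .

definition dist_fin_tree_fun :: "fin_tree_fun \<Rightarrow> fin_tree_fun \<Rightarrow> real"
  where "dist_fin_tree_fun x y = norm (x - y)"

definition sgn_fin_tree_fun :: "fin_tree_fun \<Rightarrow> fin_tree_fun"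
  where "sgn_fin_tree_fun x = inverse (norm x) *\<^sub>R x"

definition uniformity_fin_tree_fun :: "(fin_tree_fun \<times> fin_tree_fun) filter"
  where "uniformity_fin_tree_fun = (INF e\<in>{0 <..}. principal {(x, y). dist x y < e})"

definition open_fin_tree_fun :: "fin_tree_fun set \<Rightarrow> bool"
  where "open_fin_tree_fun S = (\<forall>x\<in>S. \<forall>\<^sub>F (x', y) in uniformity. x' = x \<longrightarrow> y \<in> S)"

instance
proof
  fix x y z :: fin_tree_fun and a b :: real
  show "x + y + z = x + (y + z)" by transfer (simp add: add.assoc)
  show "x + y = y + x" by transfer (simp add: add.commute)
  show "0 + x = x" by transfer simp
  show "- x + x = 0" by transfer simp
  show "x - y = x + - y" by transfer simp
  show "a *\<^sub>R (x + y) = a *\<^sub>R x + a *\<^sub>R y" by transfer (simp add: algebra_simps)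
  show "(a + b) *\<^sub>R x = a *\<^sub>R x + b *\<^sub>R x" by transfer (simp add: algebra_simps)
  show "a *\<^sub>R b *\<^sub>R x = (a * b) *\<^sub>R x" by transfer (simp add: algebra_simps)
  show "1 *\<^sub>R x = x" by transfer simp
  show "dist x y = norm (x - y)" by (fact dist_fin_tree_fun_def)
  show "sgn x = inverse (norm x) *\<^sub>R x" by (fact sgn_fin_tree_fun_def)
  show "uniformity = (INF e\<in>{0 <..}. principal {(x, y :: fin_tree_fun). dist x y < e})"
    by (fact uniformity_fin_tree_fun_def)
  show "open U = (\<forall>x\<in>U. \<forall>\<^sub>F (x', y) in uniformity. x' = x \<longrightarrow> y \<in> U)"
    for U :: "fin_tree_fun set" by (fact open_fin_tree_fun_def)
  show "norm x = 0 \<longleftrightarrow> x = 0" by transfer (auto simp: jh_norm_eq_0_iff fun_eq_iff)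
  show "norm (x + y) \<le> norm x + norm y" by transfer (rule jh_norm_triangle)
  show "norm (a *\<^sub>R x) = \<bar>a\<bar> * norm x" by transfer (rule jh_norm_scaleR)
qed

end


section \<open>The spaces JH and M\<close>

type_synonym JH = "fin_tree_fun completion"

definition N_space :: "fin_tree_fun set"
  where "N_space = {x. tree_apply x [] = 0}"

text \<open>Being closed in a complete space, \<open>M\<close> is a completion of \<^const>\<open>N_space\<close>.\<close>

typedef M = "closure (embed_completion ` N_space) :: JH set"
  morphisms JH_of_M M_of_JH
proof -
  have "0 \<in> N_space" by (simp add: N_space_def zero_fin_tree_fun.rep_eq)
  then show "\<exists>x. x \<in> closure (embed_completion ` N_space)" using closure_subset by blast
qed

setup_lifting type_definition_M

lemma subspace_N_space: "subspace N_space"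
  by (auto simp: subspace_def N_space_def zero_fin_tree_fun.rep_eq plus_fin_tree_fun.rep_eq
      scaleR_fin_tree_fun.rep_eq)

lemma linear_embed_completion: "linear embed_completion"
  by (rule linearI) (auto simp: embed_completion_add embed_completion_scaleR)

lemma subspace_closure:
  fixes S :: "'a::real_normed_vector set"
  assumes S: "subspace S"
  shows "subspace (closure S)"
proof (rule subspaceI)
  show "0 \<in> closure S" by (rule subsetD[OF closure_subset subspace_0[OF S]])
next
  fix x y assume "x \<in> closure S" "y \<in> closure S"
  then obtain u v where u: "\<And>n. u n \<in> S" "u \<longlonglongrightarrow> x" and v: "\<And>n. v n \<in> S" "v \<longlonglongrightarrow> y"
    unfolding closure_sequential by metis
  show "x + y \<in> closure S"
    unfolding closure_sequential
    by (intro exI[of _ "\<lambda>n. u n + v n"] conjI allI subspace_add[OF S] tendsto_add u v)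
next
  fix c x assume "x \<in> closure S"
  then obtain u where u: "\<And>n. u n \<in> S" "u \<longlonglongrightarrow> x"
    unfolding closure_sequential by metis
  show "c *\<^sub>R x \<in> closure S"
    unfolding closure_sequential
    by (intro exI[of _ "\<lambda>n. c *\<^sub>R u n"] conjI allI subspace_scale[OF S] tendsto_intros u)
qed

lemma subspace_M: "subspace (closure (embed_completion ` N_space))"
  by (intro subspace_closure linear_subspace_image linear_embed_completion subspace_N_space)

instantiation M :: real_normed_vector
begin

lift_definition zero_M :: M is 0 by (rule subspace_0[OF subspace_M])

lift_definition plus_M :: "M \<Rightarrow> M \<Rightarrow> M" is "(+)" by (rule subspace_add[OF subspace_M])

lift_definition minus_M :: "M \<Rightarrow> M \<Rightarrow> M" is "(-)" by (rule subspace_diff[OF subspace_M])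

lift_definition uminus_M :: "M \<Rightarrow> M" is uminus by (rule subspace_neg[OF subspace_M])

lift_definition scaleR_M :: "real \<Rightarrow> M \<Rightarrow> M" is "(*\<^sub>R)" by (rule subspace_scale[OF subspace_M])

lift_definition norm_M :: "M \<Rightarrow> real" is norm .

definition dist_M :: "M \<Rightarrow> M \<Rightarrow> real"
  where "dist_M x y = norm (x - y)"

definition sgn_M :: "M \<Rightarrow> M"
  where "sgn_M x = inverse (norm x) *\<^sub>R x"

definition uniformity_M :: "(M \<times> M) filter"
  where "uniformity_M = (INF e\<in>{0 <..}. principal {(x, y). dist x y < e})"

definition open_M :: "M set \<Rightarrow> bool"
  where "open_M S = (\<forall>x\<in>S. \<forall>\<^sub>F (x', y) in uniformity. x' = x \<longrightarrow> y \<in> S)"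

instance
proof
  fix x y z :: M and a b :: real
  show "x + y + z = x + (y + z)" by transfer (simp add: add.assoc)
  show "x + y = y + x" by transfer (simp add: add.commute)
  show "0 + x = x" by transfer simp
  show "- x + x = 0" by transfer simp
  show "x - y = x + - y" by transfer simp
  show "a *\<^sub>R (x + y) = a *\<^sub>R x + a *\<^sub>R y" by transfer (simp add: algebra_simps)
  show "(a + b) *\<^sub>R x = a *\<^sub>R x + b *\<^sub>R x" by transfer (simp add: algebra_simps)
  show "a *\<^sub>R b *\<^sub>R x = (a * b) *\<^sub>R x" by transfer (simp add: algebra_simps)
  show "1 *\<^sub>R x = x" by transfer simp
  show "dist x y = norm (x - y)" by (fact dist_M_def)
  show "sgn x = inverse (norm x) *\<^sub>R x" by (fact sgn_M_def)
  show "uniformity = (INF e\<in>{0 <..}. principal {(x, y :: M). dist x y < e})"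
    by (fact uniformity_M_def)
  show "open U = (\<forall>x\<in>U. \<forall>\<^sub>F (x', y) in uniformity. x' = x \<longrightarrow> y \<in> U)"
    for U :: "M set" by (fact open_M_def)
  show "norm x = 0 \<longleftrightarrow> x = 0" by transfer simp
  show "norm (x + y) \<le> norm x + norm y" by transfer (rule norm_triangle_ineq)
  show "norm (a *\<^sub>R x) = \<bar>a\<bar> * norm x" by transfer simp
qed

end

lemma dist_JH_of_M: "dist (JH_of_M x) (JH_of_M y) = dist x y"
  by (simp add: dist_norm norm_M.rep_eq minus_M.rep_eq)

instance M :: banach
proof
  fix X :: "nat \<Rightarrow> M" assume "Cauchy X"
  then have "Cauchy (\<lambda>n. JH_of_M (X n))" unfolding Cauchy_def dist_JH_of_M .
  then have "convergent (\<lambda>n. JH_of_M (X n))" by (rule Cauchy_convergent)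
  then obtain l where l: "(\<lambda>n. JH_of_M (X n)) \<longlonglongrightarrow> l"
    unfolding convergent_def by (rule exE)
  have "l \<in> closure (embed_completion ` N_space)"
    by (rule closed_sequentially[OF closed_closure JH_of_M l])
  then have M: "JH_of_M (M_of_JH l) = l" by (rule M_of_JH_inverse)
  have "X \<longlonglongrightarrow> M_of_JH l"
    using l unfolding lim_sequentially dist_JH_of_M[symmetric] M .
  then show "convergent X" by (rule convergentI)
qed


section \<open>The weak-star strong diameter two property\<close>

definition wstar_slice :: "'a::banach \<Rightarrow> real \<Rightarrow> ('a \<Rightarrow>\<^sub>L real) set"
  where "wstar_slice x \<alpha> =
    {f \<in> cball 0 1. blinfun_apply f x > (SUP g\<in>cball 0 1. blinfun_apply g x) - \<alpha>}"

text \<open>The type argument stands for the space whose dual has the property.\<close>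

definition dual_wstar_strong_diameter_two :: "'a::banach itself \<Rightarrow> bool"
  where "dual_wstar_strong_diameter_two (_ :: 'a itself) \<longleftrightarrow>
    (\<forall>(n::nat) (l :: nat \<Rightarrow> real) (x :: nat \<Rightarrow> 'a) (\<alpha> :: nat \<Rightarrow> real).
      (\<forall>i\<in>{1..n}. 0 \<le> l i) \<and> (\<Sum>i=1..n. l i) = 1 \<and> (\<forall>i\<in>{1..n}. 0 < \<alpha> i) \<longrightarrow>
      diameter {\<Sum>i=1..n. l i *\<^sub>R f i |f. \<forall>i\<in>{1..n}. f i \<in> wstar_slice (x i) (\<alpha> i)} = 2)"

end

theory Submission
  imports Defs
begin

text \<open>Let \<open>x\<^sub>1, \<dots>, x\<^sub>n\<close> be finitely nonzero functions vanishing at the root, let \<open>K\<close> be a number that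
  occurs in no node of their supports, and let \<open>y\<close> be the indicator function of the node
  \<open>t = (K, \<dots>, K)\<close> at a level \<open>L\<close> below all the supports. An admissible family that almost norms
  \<open>x\<^sub>i\<close> can be assumed to start at a level \<open>\<ge> 1\<close>, and it can be prolonged by entries \<open>K\<close> down to level
  \<open>L\<close> and completed by the segment through \<open>t\<close>, on which \<open>x\<^sub>i\<close> vanishes. Signed sums over this
  family are functionals of norm at most one which almost norm \<open>x\<^sub>i\<close> and take at \<open>y\<close> either of the
  values \<open>1\<close> and \<open>-1\<close>. Convex combinations of the two kinds of functionals differ by \<open>2\<close> at \<open>y\<close>.\<close>

section \<open>Extension of functionals to the completion\<close>

lemma Cauchy_blinfun_seq:
  fixes f :: "'a::real_normed_vector \<Rightarrow>\<^sub>L 'b::real_normed_vector"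
  shows "Cauchy X \<Longrightarrow> Cauchy (\<lambda>n. blinfun_apply f (X n))"
  by (rule bounded_linear.Cauchy[OF blinfun.bounded_linear_right])

text \<open>The unique continuous extension of \<open>f\<close>: a bounded linear map preserves
  Cauchy sequences and null sequences, and completeness of the target supplies the limit.\<close>

lift_definition extend_completion ::
  "('a::real_normed_vector \<Rightarrow>\<^sub>L 'b::banach) \<Rightarrow> 'a completion \<Rightarrow> 'b"
  is "\<lambda>f X. lim (\<lambda>n. blinfun_apply f (X n))"
proof -
  fix f :: "'a \<Rightarrow>\<^sub>L 'b" and X Y :: "nat \<Rightarrow> 'a"
  assume XY: "cauchy_rel X Y"
  then have "Cauchy Y" by (simp add: cauchy_rel_def)
  then have Y: "(\<lambda>n. blinfun_apply f (Y n)) \<longlonglongrightarrow> lim (\<lambda>n. blinfun_apply f (Y n))"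
    by (simp add: Cauchy_blinfun_seq Cauchy_convergent flip: convergent_LIMSEQ_iff)
  have "(\<lambda>n. X n - Y n) \<longlonglongrightarrow> 0" using XY by (simp add: cauchy_rel_def)
  then have "(\<lambda>n. blinfun_apply f (X n - Y n)) \<longlonglongrightarrow> blinfun_apply f 0"
    by (intro tendsto_intros)
  from tendsto_add[OF this Y]
  show "lim (\<lambda>n. blinfun_apply f (X n)) = lim (\<lambda>n. blinfun_apply f (Y n))"
    by (simp add: blinfun.diff_right limI)
qed

text \<open>Turns \<open>lim\<close> into actual convergence, so that the norm bound and linearity
  can be obtained by passing to limits.\<close>

lemma extend_completion_abs:
  assumes "Cauchy X"
  shows "(\<lambda>n. blinfun_apply f (X n)) \<longlonglongrightarrow> extend_completion f (abs_completion X)"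
proof -
  have "cauchy_rel X X" using assms by (simp add: cauchy_rel_def)
  then show ?thesis
    using assms by (simp add: extend_completion.abs_eq Cauchy_blinfun_seq Cauchy_convergent
        flip: convergent_LIMSEQ_iff)
qed

lemma extend_completion_embed: "extend_completion f (embed_completion x) = blinfun_apply f x"
  by transfer simp

lemma completion_cases:
  obtains X where "Cauchy X" "z = abs_completion X"
proof -
  have "\<exists>X. Cauchy X \<and> z = abs_completion X"
    by (induction z rule: completion.abs_induct) (auto simp: cauchy_rel_def)
  then show ?thesis using that by blast
qed

lemma norm_extend_completion_le:
  "norm (extend_completion f z) \<le> norm f * norm z"
proof -
  obtain X where X: "Cauchy X" "z = abs_completion X" by (rule completion_cases)
  have "(\<lambda>n. norm (X n)) \<longlonglongrightarrow> norm z"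
    using tendsto_norm[OF embed_tendsto_abs_completion[OF X(1)]]
    by (simp add: norm_embed_completion X(2))
  then show ?thesis
    unfolding X(2)
    by (intro LIMSEQ_le[OF tendsto_norm[OF extend_completion_abs[OF X(1)]]
          tendsto_mult[OF tendsto_const]]) (auto intro: norm_blinfun)
qed

lemma bounded_linear_extend_completion:
  fixes f :: "'a::real_normed_vector \<Rightarrow>\<^sub>L 'b::banach"
  shows "bounded_linear (extend_completion f)"
proof (rule bounded_linear_intro[where K = "norm f"])
  fix y z :: "'a completion"
  obtain Y where Y: "Cauchy Y" "y = abs_completion Y" by (rule completion_cases)
  obtain Z where Z: "Cauchy Z" "z = abs_completion Z" by (rule completion_cases)
  have r: "cauchy_rel Y Y" "cauchy_rel Z Z" using Y Z by (auto simp: cauchy_rel_def)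
  have "(\<lambda>n. blinfun_apply f (Y n) + blinfun_apply f (Z n)) \<longlonglongrightarrow> extend_completion f (y + z)"
    using extend_completion_abs[OF Cauchy_add_seq[OF Y(1) Z(1)], of f]
    by (simp add: blinfun.add_right Y(2) Z(2) plus_completion.abs_eq[OF r])
  with tendsto_add[OF extend_completion_abs[OF Y(1)] extend_completion_abs[OF Z(1)]]
  show "extend_completion f (y + z) = extend_completion f y + extend_completion f z"
    unfolding Y(2) Z(2) using LIMSEQ_unique by blast
next
  fix c :: real and z :: "'a completion"
  obtain Z where Z: "Cauchy Z" "z = abs_completion Z" by (rule completion_cases)
  have r: "cauchy_rel Z Z" using Z by (auto simp: cauchy_rel_def)
  have "(\<lambda>n. c *\<^sub>R blinfun_apply f (Z n)) \<longlonglongrightarrow> extend_completion f (c *\<^sub>R z)"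
    using extend_completion_abs[OF Cauchy_scaleR_seq[OF Z(1)], of f c]
    by (simp add: blinfun.scaleR_right Z(2) scaleR_completion.abs_eq[OF r])
  with tendsto_scaleR[OF tendsto_const extend_completion_abs[OF Z(1)]]
  show "extend_completion f (c *\<^sub>R z) = c *\<^sub>R extend_completion f z"
    unfolding Z(2) using LIMSEQ_unique by blast
qed (use norm_extend_completion_le[of f] in \<open>simp add: mult.commute\<close>)

lemma bounded_linear_JH_of_M: "bounded_linear JH_of_M"
  by (rule bounded_linear_intro[where K = 1])
    (simp_all add: plus_M.rep_eq scaleR_M.rep_eq norm_M.rep_eq)

text \<open>Extend \<open>f\<close> to the completion and restrict to \<open>M\<close>, which sits
  there isometrically; neither operation increases the norm.\<close>

lemma M_functional:
  fixes f :: "fin_tree_fun \<Rightarrow>\<^sub>L real"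
  obtains g :: "M \<Rightarrow>\<^sub>L real" where "norm g \<le> norm f"
    "\<And>z x. JH_of_M z = embed_completion x \<Longrightarrow> blinfun_apply g z = blinfun_apply f x"
proof
  let ?g = "Blinfun (\<lambda>z. extend_completion f (JH_of_M z))"
  have g: "blinfun_apply ?g z = extend_completion f (JH_of_M z)" for z
    by (simp add: bounded_linear_Blinfun_apply
        bounded_linear_compose[OF bounded_linear_extend_completion bounded_linear_JH_of_M])
  show "norm ?g \<le> norm f"
    by (rule norm_blinfun_bound) (simp_all add: g norm_M.rep_eq norm_extend_completion_le[of f, simplified])
  show "blinfun_apply ?g z = blinfun_apply f x" if "JH_of_M z = embed_completion x" for z x
    by (simp add: g that extend_completion_embed)
qed

section \<open>A sufficient condition for the diameter two property\<close>

text \<open>A single \<open>y\<close> serves all centres \<open>x i\<close> and both signs. Hence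
  some convex combination takes the value 1 at \<open>y\<close> and another the value -1, while all
  of them lie in the dual unit ball.\<close>

lemma dual_wstar_strong_diameter_twoI:
  assumes H: "\<And>(A :: 'a::banach set) e. finite A \<Longrightarrow> 0 < e \<Longrightarrow>
    \<exists>y. norm y \<le> 1 \<and> (\<forall>x\<in>A. \<forall>c\<in>{1, -1}. \<exists>f :: 'a \<Rightarrow>\<^sub>L real.
      norm f \<le> 1 \<and> blinfun_apply f x > norm x - e \<and> blinfun_apply f y = c)"
  shows "dual_wstar_strong_diameter_two TYPE('a)"
  unfolding dual_wstar_strong_diameter_two_def
proof (intro allI impI, elim conjE)
  fix n :: nat and l :: "nat \<Rightarrow> real" and x :: "nat \<Rightarrow> 'a" and \<alpha> :: "nat \<Rightarrow> real"
  assume l: "\<forall>i\<in>{1..n}. 0 \<le> l i" "(\<Sum>i=1..n. l i) = 1" and \<alpha>: "\<forall>i\<in>{1..n}. 0 < \<alpha> i"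
  let ?D = "{\<Sum>i=1..n. l i *\<^sub>R f i |f. \<forall>i\<in>{1..n}. f i \<in> wstar_slice (x i) (\<alpha> i)}"
  \<comment> \<open>One tolerance for all slices; the inserted 1 keeps the set nonempty without a
    look at \<open>n\<close>.\<close>
  define e where "e = Min (insert 1 (\<alpha> ` {1..n}))"
  have e: "0 < e" "\<And>i. i \<in> {1..n} \<Longrightarrow> e \<le> \<alpha> i"
    using \<alpha> unfolding e_def by (auto simp del: Min_insert intro!: Min_le)
  obtain y where y: "norm y \<le> 1" and
    ex: "\<And>i c. i \<in> {1..n} \<Longrightarrow> c \<in> {1, -1} \<Longrightarrow> \<exists>f :: 'a \<Rightarrow>\<^sub>L real.
      norm f \<le> 1 \<and> blinfun_apply f (x i) > norm (x i) - e \<and> blinfun_apply f y = c"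
    using H[OF _ e(1), of "x ` {1..n}"] unfolding ball_simps by blast
  have slice: "f \<in> wstar_slice (x i) (\<alpha> i)"
    if "i \<in> {1..n}" "norm f \<le> 1" "blinfun_apply f (x i) > norm (x i) - e" for f i
  proof -
    \<comment> \<open>As the supremum in the slice is at most the norm, an almost norming functional
      belongs to the slice.\<close>
    have "(SUP g\<in>cball 0 1. blinfun_apply g (x i)) \<le> norm (x i)"
    proof (rule cSUP_least)
      fix g :: "'a \<Rightarrow>\<^sub>L real" assume "g \<in> cball 0 1"
      then have "norm g * norm (x i) \<le> 1 * norm (x i)" by (intro mult_right_mono) auto
      then show "blinfun_apply g (x i) \<le> norm (x i)"
        using norm_blinfun[of g "x i"] by simp
    qed simp
    with that e(2)[of i] show ?thesis by (auto simp: wstar_slice_def)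
  qed
  have comb: "\<exists>u\<in>?D. blinfun_apply u y = c" if "c \<in> {1, -1}" for c
  proof -
    from ex[OF _ that] obtain f where f: "\<And>i. i \<in> {1..n} \<Longrightarrow> norm (f i) \<le> 1 \<and>
        blinfun_apply (f i) (x i) > norm (x i) - e \<and> blinfun_apply (f i) y = c"
      by metis
    have "blinfun_apply (\<Sum>i=1..n. l i *\<^sub>R f i) y = (\<Sum>i=1..n. l i * c)"
      using f by (simp add: blinfun.sum_left blinfun.scaleR_left)
    also have "\<dots> = c" using l(2) by (simp flip: sum_distrib_right)
    finally show ?thesis using f slice by blast
  qed
  have D: "u \<in> cball 0 1" if u: "u \<in> ?D" for u
  proof -
    obtain f where f: "u = (\<Sum>i=1..n. l i *\<^sub>R f i)"
      "\<And>i. i \<in> {1..n} \<Longrightarrow> f i \<in> wstar_slice (x i) (\<alpha> i)"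
      using u by blast
    have "norm u \<le> (\<Sum>i=1..n. l i * norm (f i))"
      unfolding f(1) using l(1) by (intro sum_norm_le) auto
    also have "\<dots> \<le> (\<Sum>i=1..n. l i * 1)"
      using l(1) f(2) by (intro sum_mono mult_left_mono) (auto simp: wstar_slice_def)
    finally show ?thesis using l(2) by simp
  qed
  show "diameter ?D = 2"
  proof (rule antisym)
    have "norm (u - v) \<le> 2" if "u \<in> ?D" "v \<in> ?D" for u v
      using D[OF that(1)] D[OF that(2)] norm_triangle_ineq4[of u v] by auto
    then show "diameter ?D \<le> 2" by (intro diameter_le) auto
    obtain u v where uv: "u \<in> ?D" "v \<in> ?D" "blinfun_apply u y = 1" "blinfun_apply v y = -1"
      using comb[of 1] comb[of "-1"] by auto
    have "2 = norm (blinfun_apply (u - v) y)" by (simp add: blinfun.diff_left uv)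
    also have "\<dots> \<le> norm (u - v) * norm y" by (rule norm_blinfun)
    also have "\<dots> \<le> dist u v" using mult_left_le[OF y norm_ge_zero[of "u - v"]] by (simp add: dist_norm)
    also have "\<dots> \<le> diameter ?D"
      using uv by (intro diameter_bounded_bound bounded_subset[OF bounded_cball]) (use D in blast)+
    finally show "2 \<le> diameter ?D" .
  qed
qed

section \<open>Admissible families indexed by their least nodes\<close>

definition tree_interval :: "nat list \<Rightarrow> nat list \<Rightarrow> nat list set"
  where "tree_interval a b = {u. prefix a u \<and> prefix u b}"

text \<open>An admissible family is recorded by its set \<open>A\<close> of least nodes and the map
  \<open>e\<close> to the last nodes. In this form segments can be lengthened or added without a
  separate proof of disjointness.\<close>

definition level_family :: "nat \<Rightarrow> nat \<Rightarrow> nat list set \<Rightarrow> (nat list \<Rightarrow> nat list) \<Rightarrow> bool"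
  where "level_family n m A e \<longleftrightarrow>
    finite A \<and> n \<le> m \<and> (\<forall>a\<in>A. length a = n \<and> prefix a (e a) \<and> length (e a) = m)"

lemma finite_tree_interval: "finite (tree_interval a b)"
  by (rule finite_subset[of _ "set (prefixes b)"]) (auto simp: tree_interval_def)

text \<open>A node has only one initial segment of a given length, so intervals above distinct nodes
  of one level cannot meet.\<close>

lemma level_family_disjnt:
  assumes "level_family n m A e" "a \<in> A" "b \<in> A" "a \<noteq> b"
  shows "disjnt (tree_interval a (e a)) (tree_interval b (e b))"
proof -
  have "length a = length b" using assms by (simp add: level_family_def)
  then show ?thesis
    using assms(4) by (auto simp: disjnt_iff tree_interval_def prefix_def)
qed

lemma level_family_mem:
  "level_family n m A e \<Longrightarrow> a \<in> A \<Longrightarrow> a \<in> tree_interval a (e a)"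
  by (simp add: level_family_def tree_interval_def)

lemma level_family_inj:
  assumes "level_family n m A e"
  shows "inj_on (\<lambda>a. tree_interval a (e a)) A"
  using level_family_disjnt[OF assms] level_family_mem[OF assms]
  unfolding inj_on_def disjnt_iff by metis

lemma level_family_admissible:
  assumes "level_family n m A e"
  shows "admissible ((\<lambda>a. tree_interval a (e a)) ` A)"
proof -
  have "segment n m (tree_interval a (e a))" if "a \<in> A" for a
    using assms that unfolding segment_def level_family_def tree_interval_def by blast
  moreover have "pairwise disjnt ((\<lambda>a. tree_interval a (e a)) ` A)"
    using level_family_disjnt[OF assms] unfolding pairwise_def by blast
  ultimately show ?thesis
    using assms unfolding admissible_def level_family_def by blast
qed

lemma level_family_jh_sum:
  assumes "level_family n m A e"
  shows "jh_sum x ((\<lambda>a. tree_interval a (e a)) ` A) = (\<Sum>a\<in>A. \<bar>\<Sum>u\<in>tree_interval a (e a). x u\<bar>)"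
  unfolding jh_sum_def by (simp add: sum.reindex[OF level_family_inj[OF assms]])

text \<open>Disjoint segments have distinct least nodes, so the last node is a function of the least
  one.\<close>

lemma admissible_level_family:
  assumes "admissible F"
  obtains n m A e where "level_family n m A e" "F = (\<lambda>a. tree_interval a (e a)) ` A"
proof -
  obtain n m where nm: "finite F" "n \<le> m" "\<forall>S\<in>F. segment n m S" "pairwise disjnt F"
    using assms unfolding admissible_def by blast
  then have "\<forall>S\<in>F. \<exists>s s'. prefix s s' \<and> length s = n \<and> length s' = m \<and> S = tree_interval s s'"
    unfolding segment_def tree_interval_def by blast
  then obtain s s' where s: "\<And>S. S \<in> F \<Longrightarrow>
      prefix (s S) (s' S) \<and> length (s S) = n \<and> length (s' S) = m \<and> S = tree_interval (s S) (s' S)"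
    by metis
  have mem: "s S \<in> S" if "S \<in> F" for S
  proof -
    have "s S \<in> tree_interval (s S) (s' S)" using s[OF that] unfolding tree_interval_def by blast
    then show ?thesis using s[OF that] by metis
  qed
  have inj: "inj_on s F"
  proof (rule inj_onI)
    fix S S' assume S: "S \<in> F" "S' \<in> F" "s S = s S'"
    then have "\<not> disjnt S S'" using mem[OF S(1)] mem[OF S(2)] by (auto simp: disjnt_iff)
    then show "S = S'" using nm(4) S(1,2) by (auto simp: pairwise_def)
  qed
  let ?e = "\<lambda>a. s' (inv_into F s a)"
  have "?e (s S) = s' S" if "S \<in> F" for S using inv_into_f_f[OF inj that] by simp
  then have "level_family n m (s ` F) ?e" "F = (\<lambda>a. tree_interval a (?e a)) ` (s ` F)"
    using s nm by (auto simp: level_family_def image_image)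
  then show ?thesis by (rule that)
qed

text \<open>This is where vanishing at the root enters: a segment that starts at the root loses
  nothing when the root is cut off. Starting at level 1 or later leaves room for an entry
  \<open>K\<close> in the least node of an added segment.\<close>

lemma level_family_norming:
  assumes root: "x [] = 0" and e: "e < jh_norm x"
  obtains n m A b where "level_family n m A b" "1 \<le> n"
    "e < (\<Sum>a\<in>A. \<bar>\<Sum>u\<in>tree_interval a (b a). x u\<bar>)"
proof -
  have "\<not> (\<forall>F. admissible F \<longrightarrow> jh_sum x F \<le> e)"
    using e jh_norm_least[of x e] by fastforce
  then obtain F where F: "admissible F" "e < jh_sum x F" by force
  obtain n m A b where A: "level_family n m A b" "F = (\<lambda>a. tree_interval a (b a)) ` A"
    by (rule admissible_level_family[OF F(1)])
  have e: "e < (\<Sum>a\<in>A. \<bar>\<Sum>u\<in>tree_interval a (b a). x u\<bar>)"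
    using F(2) level_family_jh_sum[OF A(1)] A(2) by simp
  show ?thesis
  proof (cases "1 \<le> n")
    case True
    then show ?thesis using that A(1) e by blast
  next
    case False
    \<comment> \<open>Here \<open>n\<close> is 0, and the root is the only node of level 0.\<close>
    with A(1) have A0: "A \<subseteq> {[]}" unfolding level_family_def
      by (metis length_0_conv less_one not_less singleton_iff subsetI)
    show ?thesis
    proof (cases "A = {} \<or> b [] = []")
      case True
      have ivl: "tree_interval [] [] = {[]}" by (auto simp: tree_interval_def)
      have "\<forall>a\<in>A. \<bar>\<Sum>u\<in>tree_interval a (b a). x u\<bar> = 0"
      proof
        fix a assume "a \<in> A"
        then have "a = []" "b a = []" using True A0 by blast+
        then show "\<bar>\<Sum>u\<in>tree_interval a (b a). x u\<bar> = 0" by (simp add: ivl root)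
      qed
      then have "(\<Sum>a\<in>A. \<bar>\<Sum>u\<in>tree_interval a (b a). x u\<bar>) = 0"
        by (rule sum.neutral)
      \<comment> \<open>The sum is 0, so \<open>e\<close> is negative and the empty family
        suffices.\<close>
      then show ?thesis
        using that[of 1 1 "{}" b] e by (simp add: level_family_def)
    next
      case False
      then obtain k v where v: "b [] = k # v" and A1: "A = {[]}"
        using A0 by (cases "b []") auto
      have "tree_interval [] (k # v) = insert [] (tree_interval [k] (k # v))"
        by (auto simp: tree_interval_def prefix_Cons)
      moreover have "[] \<notin> tree_interval [k] (k # v)" by (simp add: tree_interval_def)
      ultimately have "(\<Sum>u\<in>tree_interval [] (k # v). x u) = (\<Sum>u\<in>tree_interval [k] (k # v). x u)"
        using root by (simp add: finite_tree_interval)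
      then show ?thesis
        using that[of 1 "length (k # v)" "{[k]}" "\<lambda>_. k # v"] e v A1 by (simp add: level_family_def)
    qed
  qed
qed

text \<open>All nodes gained by the prolongation and all nodes of the added segment contain
  \<open>K\<close>, so \<open>x\<close> vanishes on them and no sum changes.\<close>

lemma level_family_extend:
  fixes x :: "nat list \<Rightarrow> real"
  assumes A: "level_family n m A b" and n: "1 \<le> n" "n \<le> L"
    and x: "\<And>u. x u \<noteq> 0 \<Longrightarrow> K \<notin> set u"
  obtains B c where "level_family n (max m L) B c"
    "replicate n K \<in> B" "c (replicate n K) = replicate (max m L) K"
    "(\<Sum>a\<in>A. \<bar>\<Sum>u\<in>tree_interval a (b a). x u\<bar>) \<le> (\<Sum>a\<in>B. \<bar>\<Sum>u\<in>tree_interval a (c a). x u\<bar>)"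
proof -
  let ?r = "replicate n K"
  \<comment> \<open>Truncated subtraction makes the new last level \<open>max m L\<close>. The
    update also overrides a segment of \<open>A\<close> that already starts at
    \<open>?r\<close>.\<close>
  define c where "c = (\<lambda>a. b a @ replicate (L - m) K)(?r := replicate (max m L) K)"
  have "prefix ?r (replicate (max m L) K)"
    unfolding prefix_def using n by (intro exI[of _ "replicate (max m L - n) K"])
      (simp flip: replicate_add)
  then have fam: "level_family n (max m L) (insert ?r A) c"
    using A n by (auto simp: level_family_def c_def)
  have K: "x u = 0" if "prefix v u" "K \<in> set v" for u v
    using set_mono_prefix[OF that(1)] that(2) x[of u] by blast
  have "\<bar>\<Sum>u\<in>tree_interval a (b a). x u\<bar> = \<bar>\<Sum>u\<in>tree_interval a (c a). x u\<bar>" if "a \<in> A" for a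
  proof (cases "a = ?r")
    \<comment> \<open>If \<open>?r\<close> was already in \<open>A\<close>, its old and new segments
      both contribute 0.\<close>
    case True
    have "K \<in> set ?r" using n by simp
    then have "x u = 0" if "u \<in> tree_interval a w" for u w
      using that K[of ?r u] True by (auto simp: tree_interval_def)
    then show ?thesis by (simp add: sum.neutral)
  next
    case False
    have "(\<Sum>u\<in>tree_interval a (b a). x u) = (\<Sum>u\<in>tree_interval a (c a). x u)"
    proof (rule sum.mono_neutral_left)
      show "tree_interval a (b a) \<subseteq> tree_interval a (c a)"
        using False by (auto simp: tree_interval_def c_def)
      show "\<forall>u\<in>tree_interval a (c a) - tree_interval a (b a). x u = 0"
      proof
        fix u assume "u \<in> tree_interval a (c a) - tree_interval a (b a)"
        then have u: "prefix u (b a @ replicate (L - m) K)" "\<not> prefix u (b a)"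
          using False by (auto simp: tree_interval_def c_def)
        then obtain w where w: "u = b a @ w" "prefix w (replicate (L - m) K)"
          by (auto simp: prefix_append)
        then have "w \<noteq> []" "set w \<subseteq> {K}"
          using u(2) set_mono_prefix[OF w(2)] by auto
        then have "K \<in> set u" using w(1) by (cases w) auto
        then show "x u = 0" using x by blast
      qed
    qed (rule finite_tree_interval)
    then show ?thesis by simp
  qed
  then have "(\<Sum>a\<in>A. \<bar>\<Sum>u\<in>tree_interval a (b a). x u\<bar>) = (\<Sum>a\<in>A. \<bar>\<Sum>u\<in>tree_interval a (c a). x u\<bar>)"
    by (rule sum.cong[OF refl])
  also have "\<dots> \<le> (\<Sum>a\<in>insert ?r A. \<bar>\<Sum>u\<in>tree_interval a (c a). x u\<bar>)"
  proof (rule sum_mono2)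
    show "finite (insert ?r A)" using A by (simp add: level_family_def)
  qed auto
  finally show ?thesis using fam that[of "insert ?r A" c] by (simp add: c_def)
qed

section \<open>Functionals that almost norm a function and have a prescribed value at a node\<close>

lift_definition node_fun :: "nat list \<Rightarrow> fin_tree_fun" is "\<lambda>t u. if u = t then 1 else 0"
  by simp

text \<open>The norm is dominated by the sum of the absolute values, which is 1 here.\<close>

lemma norm_node_fun_le: "norm (node_fun t) \<le> 1"
proof transfer
  fix t :: "nat list"
  let ?x = "\<lambda>u. if u = t then 1 else 0 :: real"
  have supp: "{u. ?x u \<noteq> 0} = {t}" by auto
  show "jh_norm ?x \<le> 1"
    using jh_sum_le[of ?x] by (intro jh_norm_least) (simp add: supp)
qed

text \<open>A sum weighted by coefficients of modulus at most 1 is bounded by the sum of absolute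
  values over an admissible family, hence by the norm.\<close>

lemma level_family_functional:
  assumes A: "level_family n m A b" and \<sigma>: "\<And>a. a \<in> A \<Longrightarrow> \<bar>\<sigma> a\<bar> \<le> (1 :: real)"
  obtains f :: "fin_tree_fun \<Rightarrow>\<^sub>L real" where "norm f \<le> 1"
    "\<And>x. blinfun_apply f x = (\<Sum>a\<in>A. \<sigma> a * (\<Sum>u\<in>tree_interval a (b a). tree_apply x u))"
proof -
  let ?f = "\<lambda>x. \<Sum>a\<in>A. \<sigma> a * (\<Sum>u\<in>tree_interval a (b a). tree_apply x u)"
  have le: "\<bar>?f x\<bar> \<le> norm x" for x
  proof -
    have "\<bar>?f x\<bar> \<le> (\<Sum>a\<in>A. \<bar>\<sigma> a\<bar> * \<bar>\<Sum>u\<in>tree_interval a (b a). tree_apply x u\<bar>)"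
      unfolding abs_mult[symmetric] by (rule sum_abs)
    also have "\<dots> \<le> (\<Sum>a\<in>A. 1 * \<bar>\<Sum>u\<in>tree_interval a (b a). tree_apply x u\<bar>)"
      using \<sigma> by (intro sum_mono mult_right_mono) auto
    also have "\<dots> \<le> jh_norm (tree_apply x)"
      using jh_sum_le_jh_norm[OF finite_supp_tree_apply level_family_admissible[OF A]]
      by (simp add: level_family_jh_sum[OF A])
    finally show ?thesis by (simp add: norm_fin_tree_fun.rep_eq)
  qed
  have bl: "bounded_linear ?f"
  proof (rule bounded_linear_intro[where K = 1])
    show "?f (x + y) = ?f x + ?f y" for x y
      by (simp add: plus_fin_tree_fun.rep_eq sum.distrib distrib_left)
    show "?f (r *\<^sub>R x) = r *\<^sub>R ?f x" for r x
      by (simp add: scaleR_fin_tree_fun.rep_eq sum_distrib_left mult.left_commute)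
  qed (use le in simp)
  show ?thesis
    by (rule that[of "Blinfun ?f"])
      (use le in \<open>auto intro!: norm_blinfun_bound simp: bounded_linear_Blinfun_apply[OF bl]\<close>)
qed

text \<open>The segment through \<open>replicate L K\<close> carries no mass of \<open>x\<close>, so
  its coefficient is free: it fixes the value at the node and leaves the value at \<open>x\<close>
  alone.\<close>

lemma fin_tree_fun_functional:
  assumes x: "x \<in> N_space" "\<And>u. tree_apply x u \<noteq> 0 \<Longrightarrow> K \<notin> set u \<and> length u < L"
    and L: "1 \<le> L" and e: "e < norm x" and c: "\<bar>c\<bar> \<le> 1"
  obtains f :: "fin_tree_fun \<Rightarrow>\<^sub>L real" where "norm f \<le> 1"
    "e < blinfun_apply f x" "blinfun_apply f (node_fun (replicate L K)) = c"
proof -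
  have "\<exists>n m A b. level_family n m A b \<and> 1 \<le> n \<and> n \<le> L \<and>
    e < (\<Sum>a\<in>A. \<bar>\<Sum>u\<in>tree_interval a (b a). tree_apply x u\<bar>)"
  proof -
    obtain n m A b where A: "level_family n m A b" "1 \<le> n"
      "e < (\<Sum>a\<in>A. \<bar>\<Sum>u\<in>tree_interval a (b a). tree_apply x u\<bar>)"
      by (rule level_family_norming[of "tree_apply x" e])
        (use x(1) e in \<open>auto simp: N_space_def norm_fin_tree_fun.rep_eq\<close>)
    show ?thesis
    proof (cases "n \<le> L")
      \<comment> \<open>All segments then start below the support of \<open>x\<close>, so
        \<open>e\<close> is negative and the empty family at level 1 will do.\<close>
      case False
      have "tree_apply x u = 0" if "a \<in> A" "u \<in> tree_interval a (b a)" for a u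
      proof -
        have "n \<le> length u"
          using that A(1) prefix_length_le[of a u] by (auto simp: level_family_def tree_interval_def)
        then show ?thesis using x(2)[of u] False by fastforce
      qed
      then have "(\<Sum>a\<in>A. \<bar>\<Sum>u\<in>tree_interval a (b a). tree_apply x u\<bar>) = 0"
        by (simp add: sum.neutral)
      then show ?thesis
        using A(3) L by (intro exI[of _ 1] exI[of _ "{}"]) (auto simp: level_family_def)
    qed (use A in blast)
  qed
  then obtain n m A b where A: "level_family n m A b" and n: "1 \<le> n" "n \<le> L"
    and eA: "e < (\<Sum>a\<in>A. \<bar>\<Sum>u\<in>tree_interval a (b a). tree_apply x u\<bar>)"
    by blast
  let ?r = "replicate n K" and ?t = "replicate L K"
  obtain B d where B: "level_family n (max m L) B d" "?r \<in> B" "d ?r = replicate (max m L) K"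
    "(\<Sum>a\<in>A. \<bar>\<Sum>u\<in>tree_interval a (b a). tree_apply x u\<bar>)
      \<le> (\<Sum>a\<in>B. \<bar>\<Sum>u\<in>tree_interval a (d a). tree_apply x u\<bar>)"
    by (rule level_family_extend[where x = "tree_apply x" and K = K, OF A n]) (use x(2) in blast)+
  define s where "s a = (\<Sum>u\<in>tree_interval a (d a). tree_apply x u)" for a
  \<comment> \<open>Signs norm \<open>x\<close> on the other segments; the segment starting at
    \<open>?r\<close> receives the prescribed \<open>c\<close>.\<close>
  define \<sigma> where "\<sigma> = (\<lambda>a. sgn (s a))(?r := c)"
  have "\<bar>\<sigma> a\<bar> \<le> 1" for a using c by (simp add: \<sigma>_def sgn_if)
  then obtain f :: "fin_tree_fun \<Rightarrow>\<^sub>L real" where f: "norm f \<le> 1"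
    "\<And>x. blinfun_apply f x = (\<Sum>a\<in>B. \<sigma> a * (\<Sum>u\<in>tree_interval a (d a). tree_apply x u))"
    using level_family_functional[OF B(1)] by metis
  have "tree_apply x u = 0" if "u \<in> tree_interval ?r (d ?r)" for u
  proof -
    have "K \<in> set u" using that n by (auto simp: tree_interval_def prefix_def)
    then show ?thesis using x(2) by blast
  qed
  then have "s ?r = 0" by (simp add: s_def)
  then have "\<sigma> a * s a = \<bar>s a\<bar>" for a by (simp add: \<sigma>_def abs_sgn mult.commute)
  then have "blinfun_apply f x = (\<Sum>a\<in>B. \<bar>s a\<bar>)" by (simp add: f(2) flip: s_def)
  then have 1: "e < blinfun_apply f x" using eA B(4) by (simp add: s_def)
  have rep: "prefix (replicate i K) (replicate j K)" if "i \<le> j" for i j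
    unfolding prefix_def using that
    by (intro exI[of _ "replicate (j - i) K"]) (simp flip: replicate_add)
  have tr: "?t \<in> tree_interval ?r (d ?r)"
    using rep n by (simp add: tree_interval_def B(3))
  have t: "(\<Sum>u\<in>tree_interval a (d a). tree_apply (node_fun ?t) u) = (if a = ?r then 1 else 0)"
    if "a \<in> B" for a
  proof -
    \<comment> \<open>By disjointness only the segment starting at \<open>?r\<close> sees the node
      \<open>?t\<close>.\<close>
    have "?t \<in> tree_interval a (d a) \<longleftrightarrow> a = ?r"
      using tr level_family_disjnt[OF B(1) that B(2)] by (auto simp: disjnt_iff)
    then show ?thesis by (simp add: node_fun.rep_eq finite_tree_interval)
  qed
  have "blinfun_apply f (node_fun ?t) = (\<Sum>a\<in>B. \<sigma> a * (if a = ?r then 1 else 0))"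
    unfolding f(2) using t by (intro sum.cong) auto
  also have "\<dots> = \<sigma> ?r"
    using B(1,2) unfolding level_family_def by (simp add: if_distrib cong: if_cong)
  finally have "blinfun_apply f (node_fun ?t) = c" by (simp add: \<sigma>_def)
  with f(1) 1 show ?thesis by (rule that)
qed

section \<open>Choice of the node and approximation in \<open>M\<close>\<close>

text \<open>Only finitely many entries and levels occur in the supports, whereas every node has
  infinitely many successors; this provides a fresh \<open>K\<close>.\<close>

lemma finite_tree_fun_bound:
  assumes "finite A"
  obtains K L where "1 \<le> (L :: nat)"
    "\<And>x u. x \<in> A \<Longrightarrow> tree_apply x u \<noteq> 0 \<Longrightarrow> K \<notin> set u \<and> length u < L"
proof -
  let ?U = "\<Union>x\<in>A. {u. tree_apply x u \<noteq> 0}"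
  have U: "finite ?U" using assms finite_supp_tree_apply by blast
  then have "finite (\<Union>u\<in>?U. set u)" by blast
  then obtain K where K: "K \<notin> (\<Union>u\<in>?U. set u)"
    using ex_new_if_finite[OF infinite_UNIV_nat] by blast
  obtain L where L: "\<And>i. i \<in> length ` ?U \<Longrightarrow> i < L"
    using U finite_nat_set_iff_bounded[of "length ` ?U"] by blast
  show ?thesis
    by (rule that[of "Suc L" K]) (use K L in \<open>force dest: less_SucI\<close>)+
qed

lemma JH_of_M_embed:
  "x \<in> N_space \<Longrightarrow> JH_of_M (M_of_JH (embed_completion x)) = embed_completion x"
  by (intro M_of_JH_inverse subsetD[OF closure_subset] imageI)

text \<open>\<open>M\<close> is by construction the closure of the embedded \<open>N_space\<close>,
  so finitely nonzero functions are dense in it.\<close>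

lemma M_approx:
  assumes "0 < e"
  obtains x z where "x \<in> N_space" "JH_of_M z = embed_completion x" "norm (y - z) < e"
proof -
  obtain x where x: "x \<in> N_space" "dist (embed_completion x) (JH_of_M y) < e"
    using JH_of_M[of y] assms unfolding closure_approachable by blast
  let ?z = "M_of_JH (embed_completion x)"
  have z: "JH_of_M ?z = embed_completion x" by (rule JH_of_M_embed[OF x(1)])
  have "norm (y - ?z) < e"
    using x(2) dist_JH_of_M[of ?z y] by (simp add: z dist_commute flip: dist_norm)
  with x(1) z show ?thesis by (rule that)
qed

theorem theorem5p2:
  shows "dual_wstar_strong_diameter_two TYPE(M)"
proof (rule dual_wstar_strong_diameter_twoI)
  fix A :: "M set" and e :: real
  assume A: "finite A" and e: "0 < e"
  \<comment> \<open>One third each for the change of the norm from \<open>y\<close> to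
    \<open>z y\<close>, the change of the functional, and the norming defect.\<close>
  from e have e3: "0 < e / 3" by simp
  have "\<exists>x z. x \<in> N_space \<and> JH_of_M z = embed_completion x \<and> norm (y - z) < e / 3" for y
    by (rule M_approx[OF e3, of y]) blast
  then obtain x z where
    xz: "\<And>y. x y \<in> N_space" "\<And>y. JH_of_M (z y) = embed_completion (x y)" "\<And>y. norm (y - z y) < e / 3"
    by metis
  obtain K L where KL: "1 \<le> L"
    "\<And>y u. y \<in> A \<Longrightarrow> tree_apply (x y) u \<noteq> 0 \<Longrightarrow> K \<notin> set u \<and> length u < L"
    using finite_tree_fun_bound[of "x ` A"] A by (metis finite_imageI imageI)
  let ?t = "node_fun (replicate L K)"
  \<comment> \<open>As \<open>L\<close> is at least 1, the node differs from the root.\<close>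
  have "?t \<in> N_space" using KL(1) by (auto simp: N_space_def node_fun.rep_eq)
  then have t: "JH_of_M (M_of_JH (embed_completion ?t)) = embed_completion ?t"
    by (rule JH_of_M_embed)
  show "\<exists>w. norm w \<le> 1 \<and> (\<forall>y\<in>A. \<forall>c\<in>{1, -1}. \<exists>f :: M \<Rightarrow>\<^sub>L real.
      norm f \<le> 1 \<and> norm y - e < blinfun_apply f y \<and> blinfun_apply f w = c)"
  proof (intro exI[of _ "M_of_JH (embed_completion ?t)"] conjI ballI)
    show "norm (M_of_JH (embed_completion ?t)) \<le> 1"
      by (simp add: norm_M.rep_eq t norm_embed_completion norm_node_fun_le)
    fix y c assume y: "y \<in> A" and c: "c \<in> {1, -1 :: real}"
    have lt: "norm (x y) - e / 3 < norm (x y)" and c1: "\<bar>c\<bar> \<le> 1" using e c by auto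
    obtain f :: "fin_tree_fun \<Rightarrow>\<^sub>L real" where f: "norm f \<le> 1"
      "norm (x y) - e / 3 < blinfun_apply f (x y)" "blinfun_apply f ?t = c"
      by (rule fin_tree_fun_functional[OF xz(1) KL(2)[OF y] KL(1) lt c1])
    obtain g :: "M \<Rightarrow>\<^sub>L real" where g: "norm g \<le> norm f"
      "\<And>z x. JH_of_M z = embed_completion x \<Longrightarrow> blinfun_apply g z = blinfun_apply f x"
      by (rule M_functional[of f]) blast
    have g1: "norm g \<le> 1" using f(1) g(1) by simp
    have "norm (blinfun_apply g (y - z y)) \<le> norm g * norm (y - z y)" by (rule norm_blinfun)
    also have "\<dots> \<le> norm (y - z y)" using g1 by (intro mult_left_le_one_le) auto
    finally have "blinfun_apply g (z y) - blinfun_apply g y < e / 3"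
      using xz(3)[of y] by (simp add: blinfun.diff_right)
    moreover have "blinfun_apply g (z y) > norm (z y) - e / 3"
      using f(2) g(2)[OF xz(2)] by (simp add: norm_M.rep_eq xz(2) norm_embed_completion)
    moreover have "norm y - norm (z y) < e / 3"
      using xz(3)[of y] norm_triangle_ineq2[of y "z y"] by linarith
    ultimately have "norm y - e < blinfun_apply g y" by argo
    then show "\<exists>f. norm f \<le> 1 \<and> norm y - e < blinfun_apply f y \<and>
        blinfun_apply f (M_of_JH (embed_completion ?t)) = c"
      using g1 g(2)[OF t] f(3) by blast
  qed
qed

end
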